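(* Let $N$ be a positive integer, let $A_0,A_1,A_2,A_3,B_0,B_1,D_0,D_1,D_2,E,F_0,F_1,F_2,F_3,F_4,G_0,G_1,G_2,G_3$ be arbitrary complex constants, and let $z_1(t),\dots,z_N(t)$ be twice continuously differentiable complex-valued functions of the real variable $t$ on an open interval, pairwise distinct at every $t$. Put $\psi(z,t)=\prod_{n=1}^N[z-z_n(t)]$. Then the functions $z_n(t)$ satisfy the Newtonian $N$-body equations of motion $$\ddot z_n+E\dot z_n=B_0+B_1z_n-(N-1)[2A_3+3(N-2)F_4]z_n^2+(N-1)(N-2)G_3\dot z_nz_n$$ $$+\sum_{\ell=1;\,\ell\ne n}^N\frac{2\dot z_n\dot z_\ell+2(A_0+A_1z_n+A_2z_n^2+A_3z_n^3)-(\dot z_n+\dot z_\ell)(D_0+D_1z_n)-D_2z_n(\dot z_nz_\ell+\dot z_\ell z_n)}{z_n-z_\ell}$$ $$+\sum_{k,\ell=1;\,k\ne n,\,\ell\ne n,\,k\ne\ell}^N\bigg[\frac{3(F_0+F_1z_n+F_2z_n^2+F_3z_n^3+F_4z_n^4)}{(z_n-z_\ell)(z_n-z_k)}-\frac{G_0+G_1z_n+G_2z_n^2+G_3z_n^3}{z_n-z_\ell}\Big(\frac{\dot z_n+\dot z_k}{z_n-z_k}+\frac{\dot z_\ell+\dot z_k}{z_\ell-z_k}\Big)\bigg],\quad n=1,\dots,N,$$ if and only if $\psi$ satisfies the linear partial differential equation $$\psi_{tt}+\{E-(N-1)[D_2+(N-2)G_3]z\}\psi_t+(G_0+G_1z+G_2z^2+G_3z^3)\psi_{zzt}+(D_0+D_1z+D_2z^2)\psi_{zt}$$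 $$+(F_0+F_1z+F_2z^2+F_3z^3+F_4z^4)\psi_{zzz}+(A_0+A_1z+A_2z^2+A_3z^3)\psi_{zz}$$ $$+\{B_0+B_1z-(N-1)[2A_3+3(N-2)F_4]z^2\}\psi_z$$ $$+N\{-B_1-(N-1)[A_2+(N-2)F_3]+(N-1)[A_3+2(N-2)F_4]z\}\psi=0$$ for all complex $z$ and all $t$ in the interval.
   Context: Dots denote derivatives with respect to $t$; subscripts $z$ and $t$ on $\psi$ denote partial derivatives. Empty sums are zero. *)

theory Defs
  imports "HOL-Analysis.Analysis"
begin

definition dot :: "(real \<Rightarrow> complex) \<Rightarrow> real \<Rightarrow> complex" where
  "dot f t = vector_derivative f (at t)"

(* Meant for open S only: C1_differentiable_on uses the two-sided derivative at each point of S. *)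
definition C2_on :: "(real \<Rightarrow> complex) \<Rightarrow> real set \<Rightarrow> bool" where
  "C2_on f S \<longleftrightarrow> f C1_differentiable_on S \<and> dot f C1_differentiable_on S"

definition d_z :: "(complex \<Rightarrow> real \<Rightarrow> complex) \<Rightarrow> complex \<Rightarrow> real \<Rightarrow> complex" where
  "d_z f w t = deriv (\<lambda>x. f x t) w"

definition d_t :: "(complex \<Rightarrow> real \<Rightarrow> complex) \<Rightarrow> complex \<Rightarrow> real \<Rightarrow> complex" where
  "d_t f w t = dot (f w) t"

definition psi :: "nat \<Rightarrow> (nat \<Rightarrow> real \<Rightarrow> complex) \<Rightarrow> complex \<Rightarrow> real \<Rightarrow> complex" where
  "psi N z w t = (\<Prod>n\<in>{1..N}. w - z n t)"

end

(* For fixed t the left-hand side of the equation is a polynomial in z. Its coefficients of z^N and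
   z^(N+1) cancel, so it has degree less than N and vanishes identically iff it vanishes at the N
   distinct zeros z_n(t). At z = z_n it is, up to sign, the product of the z_n - z_l times the defect of the
   n-th equation of motion. The identity
     (v_l + v_k) / (z_l - z_k) * (1 / (z_n - z_l) - 1 / (z_n - z_k))
       = (v_l + v_k) / ((z_n - z_l) (z_n - z_k)),
   symmetrised over k and l, accounts for the shape of the terms with the coefficients G. *)
theory Submission
  imports Defs "HOL-Computational_Algebra.Polynomial"
begin

subsection \<open>Monic polynomials and the formal time derivatives induced by their zeros\<close>

definition root_poly :: "'i set \<Rightarrow> ('i \<Rightarrow> complex) \<Rightarrow> complex poly" where
  "root_poly S x = (\<Prod>m\<in>S. [:- x m, 1:])"

text \<open>The product rule for zeros \<open>x m\<close> moving with velocities \<open>v m\<close>.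
  No time variable occurs, so all identities below stay algebraic; that this is the true time
  derivative is proved separately.\<close>

definition root_poly_t :: "'i set \<Rightarrow> ('i \<Rightarrow> complex) \<Rightarrow> ('i \<Rightarrow> complex) \<Rightarrow> complex poly" where
  "root_poly_t S x v = (\<Sum>l\<in>S. smult (- v l) (root_poly (S - {l}) x))"

text \<open>Termwise derivative of \<open>root_poly_t\<close> with accelerations \<open>a\<close>,
  in exactly the shape that the product rule for \<open>smult\<close> yields.\<close>

definition root_poly_tt ::
  "'i set \<Rightarrow> ('i \<Rightarrow> complex) \<Rightarrow> ('i \<Rightarrow> complex) \<Rightarrow> ('i \<Rightarrow> complex) \<Rightarrow> complex poly" where
  "root_poly_tt S x v a =
     (\<Sum>l\<in>S. smult (- a l) (root_poly (S - {l}) x) + smult (- v l) (root_poly_t (S - {l}) x v))"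

lemma smult_sum_right: "smult c (sum f S) = (\<Sum>l\<in>S. smult c (f l))"
  by (induction S rule: infinite_finite_induct) (simp_all add: smult_add_right)

lemma root_poly_insert:
  assumes "finite S" "n \<notin> S"
  shows "root_poly (insert n S) x = [:- x n, 1:] * root_poly S x"
  using assms by (simp add: root_poly_def)

lemma root_poly_t_insert:
  assumes "finite S" "n \<notin> S"
  shows "root_poly_t (insert n S) x v =
    smult (- v n) (root_poly S x) + [:- x n, 1:] * root_poly_t S x v"
proof -
  have "root_poly (insert n S - {l}) x = [:- x n, 1:] * root_poly (S - {l}) x" if "l \<in> S" for l
  proof -
    have "insert n S - {l} = insert n (S - {l})" using that assms by auto
    then show ?thesis using assms by (simp only: root_poly_insert finite_Diff Diff_iff simp_thms)
  qed
  then have "(\<Sum>l\<in>S. smult (- v l) (root_poly (insert n S - {l}) x)) =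
      [:- x n, 1:] * root_poly_t S x v"
    unfolding root_poly_t_def sum_distrib_left by (intro sum.cong) (simp_all only: mult_smult_right)
  then show ?thesis
    using assms unfolding root_poly_t_def[of "insert n S"] by simp
qed

text \<open>Second-order Leibniz rule for a linear factor times the rest. Isolating one zero
  \<open>n\<close> pays off at \<open>x n\<close>, where the linear factor vanishes.\<close>

lemma root_poly_tt_insert:
  assumes "finite S" "n \<notin> S"
  shows "root_poly_tt (insert n S) x v a =
    smult (- a n) (root_poly S x) + smult (- 2 * v n) (root_poly_t S x v)
      + [:- x n, 1:] * root_poly_tt S x v a"
proof -
  let ?L = "[:- x n, 1:]"
  have "smult (- a l) (root_poly (insert n S - {l}) x)
        + smult (- v l) (root_poly_t (insert n S - {l}) x v)
      = ?L * (smult (- a l) (root_poly (S - {l}) x) + smult (- v l) (root_poly_t (S - {l}) x v))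
        + smult (- v n) (smult (- v l) (root_poly (S - {l}) x))" if "l \<in> S" for l
  proof -
    have eq: "insert n S - {l} = insert n (S - {l})" using that assms by auto
    have fin: "finite (S - {l})" "n \<notin> S - {l}" using assms by auto
    show ?thesis
      unfolding eq root_poly_insert[OF fin] root_poly_t_insert[OF fin]
      by (simp only: smult_add_right distrib_left mult_smult_right smult_smult ac_simps)
  qed
  then have "(\<Sum>l\<in>S. smult (- a l) (root_poly (insert n S - {l}) x)
        + smult (- v l) (root_poly_t (insert n S - {l}) x v))
      = ?L * root_poly_tt S x v a + smult (- v n) (root_poly_t S x v)"
    unfolding root_poly_tt_def root_poly_t_def[of S] sum_distrib_left smult_sum_right sum.distrib[symmetric]
    by (intro sum.cong) simp_all
  \<comment> \<open>One of the two mixed terms comes from the summand \<open>l = n\<close>, the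
    other from differentiating the factor of \<open>n\<close> in the summands
    \<open>l \<in> S\<close>.\<close>
  moreover have "smult (- 2 * v n) (root_poly_t S x v) =
      smult (- v n) (root_poly_t S x v) + smult (- v n) (root_poly_t S x v)"
    by (simp only: smult_add_left[symmetric]) simp
  moreover have "root_poly_tt (insert n S) x v a =
      (smult (- a n) (root_poly S x) + smult (- v n) (root_poly_t S x v))
      + (\<Sum>l\<in>S. smult (- a l) (root_poly (insert n S - {l}) x)
          + smult (- v l) (root_poly_t (insert n S - {l}) x v))"
    using assms by (simp add: root_poly_tt_def[of "insert n S"])
  ultimately show ?thesis
    by (simp only: ac_simps)
qed

section \<open>Degree bounds, and values away from the zeros\<close>

lemma degree_root_poly:
  assumes "finite S"
  shows "degree (root_poly S x) = card S"
  using degree_prod_eq_sum_degree[of S "\<lambda>m. [:- x m, 1:]"] assms by (simp add: root_poly_def)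

lemma poly_root_poly: "poly (root_poly S x) w = (\<Prod>m\<in>S. w - x m)"
  by (simp add: root_poly_def poly_prod)

lemma degree_root_poly_remove_le:
  assumes "finite S" "l \<in> S"
  shows "degree (root_poly (S - {l}) x) \<le> card S - 1"
  using assms by (simp add: degree_root_poly)

lemma degree_root_poly_t_le:
  assumes "finite S"
  shows "degree (root_poly_t S x v) \<le> card S - 1"
  unfolding root_poly_t_def
  by (intro degree_sum_le assms order.trans[OF degree_smult_le] degree_root_poly_remove_le)

lemma degree_root_poly_tt_le:
  assumes "finite S"
  shows "degree (root_poly_tt S x v a) \<le> card S - 1"
  unfolding root_poly_tt_def
proof (intro degree_sum_le assms degree_add_le order.trans[OF degree_smult_le]
    degree_root_poly_remove_le)
  fix l assume "l \<in> S"
  then show "degree (root_poly_t (S - {l}) x v) \<le> card S - 1"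
    using degree_root_poly_t_le[of "S - {l}" x v] assms by simp
qed

lemma poly_root_poly_remove:
  assumes "finite S" "l \<in> S" "w \<noteq> x l"
  shows "poly (root_poly (S - {l}) x) w = poly (root_poly S x) w / (w - x l)"
  using assms by (simp add: poly_root_poly prod.remove[of S l])

lemma pderiv_sum: "pderiv (sum f S) = (\<Sum>l\<in>S. pderiv (f l))"
  using higher_pderiv_sum[of 1 f S] by simp

lemma pderiv_root_poly: "pderiv (root_poly S x) = (\<Sum>l\<in>S. root_poly (S - {l}) x)"
  unfolding root_poly_def by (simp add: pderiv_prod pderiv_pCons)

text \<open>Logarithmic derivative: away from the zeros, removing a factor is division by it. This
  lemma and the next three produce the sums over the other particles; they will be applied with
  \<open>w\<close> a zero that lies outside \<open>S\<close>.\<close>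

lemma poly_pderiv_root_poly:
  assumes "finite S" "\<And>l. l \<in> S \<Longrightarrow> w \<noteq> x l"
  shows "poly (pderiv (root_poly S x)) w = poly (root_poly S x) w * (\<Sum>l\<in>S. 1 / (w - x l))"
  using assms by (simp add: pderiv_root_poly poly_sum poly_root_poly_remove sum_distrib_left)

lemma poly_root_poly_t:
  assumes "finite S" "\<And>l. l \<in> S \<Longrightarrow> w \<noteq> x l"
  shows "poly (root_poly_t S x v) w = poly (root_poly S x) w * (\<Sum>l\<in>S. - v l / (w - x l))"
  using assms by (simp add: root_poly_t_def poly_sum poly_root_poly_remove sum_distrib_left field_simps)

lemma poly_pderiv2_root_poly:
  assumes "finite S" "\<And>l. l \<in> S \<Longrightarrow> w \<noteq> x l"
  shows "poly (pderiv (pderiv (root_poly S x))) w =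
    poly (root_poly S x) w * (\<Sum>k\<in>S. \<Sum>l\<in>S - {k}. 1 / ((w - x l) * (w - x k)))"
  unfolding pderiv_root_poly[of S] pderiv_sum poly_sum sum_distrib_left[of "poly _ _"]
proof (rule sum.cong[OF refl])
  fix k assume k: "k \<in> S"
  have "poly (pderiv (root_poly (S - {k}) x)) w =
      poly (root_poly (S - {k}) x) w * (\<Sum>l\<in>S - {k}. 1 / (w - x l))"
    using assms by (intro poly_pderiv_root_poly) auto
  then show "poly (pderiv (root_poly (S - {k}) x)) w =
      (\<Sum>l\<in>S - {k}. poly (root_poly S x) w * (1 / ((w - x l) * (w - x k))))"
    using assms k by (simp add: poly_root_poly_remove sum_distrib_left mult_ac)
qed

text \<open>In each ordered pair, \<open>k\<close> is the factor hit by the time derivative and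
  \<open>l\<close> the one hit by the derivative in z, so only \<open>v k\<close> appears.\<close>

lemma poly_pderiv_root_poly_t:
  assumes "finite S" "\<And>l. l \<in> S \<Longrightarrow> w \<noteq> x l"
  shows "poly (pderiv (root_poly_t S x v)) w =
    poly (root_poly S x) w * (\<Sum>k\<in>S. \<Sum>l\<in>S - {k}. - v k / ((w - x l) * (w - x k)))"
  unfolding root_poly_t_def pderiv_sum pderiv_smult poly_sum sum_distrib_left[of "poly _ _"]
proof (rule sum.cong[OF refl])
  fix k assume k: "k \<in> S"
  have "poly (pderiv (root_poly (S - {k}) x)) w =
      poly (root_poly (S - {k}) x) w * (\<Sum>l\<in>S - {k}. 1 / (w - x l))"
    using assms by (intro poly_pderiv_root_poly) auto
  then show "poly (smult (- v k) (pderiv (root_poly (S - {k}) x))) w =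
      (\<Sum>l\<in>S - {k}. poly (root_poly S x) w * (- v k / ((w - x l) * (w - x k))))"
    using assms k by (simp add: poly_root_poly_remove sum_distrib_left sum_negf mult_ac)
qed

subsection \<open>The differential operator at the zeros\<close>

text \<open>The left-hand side of the differential equation at a fixed time, as a polynomial in z;
  \<open>p'\<close> and \<open>p''\<close> stand for the first and second time derivatives of
  \<open>p\<close>.\<close>

definition pde_poly where
  "pde_poly C G D F A B H p p' p'' =
     p'' + C * p' + G * pderiv (pderiv p') + D * pderiv p'
     + F * pderiv (pderiv (pderiv p)) + A * pderiv (pderiv p) + B * pderiv p
     + H * (p :: complex poly)"

lemma sum_offdiag_swap:
  assumes "finite S"
  shows "(\<Sum>k\<in>S. \<Sum>l\<in>S - {k}. f k l) = (\<Sum>k\<in>S. \<Sum>l\<in>S - {k}. f l k)"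
proof -
  have "(\<Sum>k\<in>S. \<Sum>l\<in>S - {k}. f k l) = (\<Sum>k\<in>S. \<Sum>l\<in>{l\<in>S. k \<noteq> l}. f k l)"
    by (intro sum.cong) auto
  also have "\<dots> = (\<Sum>l\<in>S. \<Sum>k\<in>{k\<in>S. k \<noteq> l}. f k l)"
    by (rule sum.swap_restrict[OF assms assms])
  also have "\<dots> = (\<Sum>k\<in>S. \<Sum>l\<in>S - {k}. f l k)"
    by (intro sum.cong) auto
  finally show ?thesis .
qed

text \<open>Removes the differences \<open>x l - x k\<close>, which no derivative at
  \<open>w\<close> produces. Adding each summand to its mirror image under exchange of
  \<open>k\<close> and \<open>l\<close> leaves 1/(w - x l) - 1/(w - x k), whose numerator is
  \<open>x l - x k\<close> and cancels the denominator.\<close>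

lemma sum_velocity_pairs:
  fixes x v :: "'i \<Rightarrow> complex"
  assumes "finite S" "\<And>l. l \<in> S \<Longrightarrow> w \<noteq> x l" "inj_on x S"
  shows "(\<Sum>k\<in>S. \<Sum>l\<in>S - {k}. (v l + v k) / ((w - x l) * (x l - x k))) =
         (\<Sum>k\<in>S. \<Sum>l\<in>S - {k}. v k / ((w - x l) * (w - x k)))"
    (is "?L = ?R")
proof -
  have "?L + ?L = (\<Sum>k\<in>S. \<Sum>l\<in>S - {k}. (v l + v k) / ((w - x l) * (x l - x k)))
      + (\<Sum>k\<in>S. \<Sum>l\<in>S - {k}. (v k + v l) / ((w - x k) * (x k - x l)))"
    by (subst (2) sum_offdiag_swap[OF assms(1)]) simp
  also have "\<dots> = (\<Sum>k\<in>S. \<Sum>l\<in>S - {k}. v k / ((w - x l) * (w - x k)) + v l / ((w - x k) * (w - x l)))"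
    unfolding sum.distrib[symmetric]
  proof (intro sum.cong refl)
    fix k l assume kl: "k \<in> S" "l \<in> S - {k}"
    then have "x k \<noteq> x l" using assms(3) by (auto dest: inj_onD)
    then show "(v l + v k) / ((w - x l) * (x l - x k)) + (v k + v l) / ((w - x k) * (x k - x l)) =
        v k / ((w - x l) * (w - x k)) + v l / ((w - x k) * (w - x l))"
      using kl assms(2)[of k] assms(2)[of l] by (simp add: divide_simps) (simp add: algebra_simps)
  qed
  also have "\<dots> = ?R + ?R"
    unfolding sum.distrib by (subst (2) sum_offdiag_swap[OF assms(1)]) simp
  finally show ?thesis by simp
qed

text \<open>Write p = L Q with L vanishing at \<open>w\<close> and L' = 1. At \<open>w\<close> the
  j-th z-derivative of p is j times the (j-1)-th of Q, whence the factors 2 and 3, and the term with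
  \<open>H\<close> drops out. Likewise p_t = - v_n Q, p_tt = - a_n Q - 2 v_n Q_t, p_zt = - v_n Q_z +
  Q_t and p_zzt = - v_n Q_zz + 2 Q_zt.\<close>

lemma poly_pde_poly_at_root:
  assumes fin: "finite S" and n: "n \<notin> S" and inj: "inj_on x (insert n S)"
  defines "w \<equiv> x n"
  shows "poly (pde_poly C G D F A B H (root_poly (insert n S) x) (root_poly_t (insert n S) x v)
            (root_poly_tt (insert n S) x v a)) w =
    poly (root_poly S x) w *
      (- a n - poly C w * v n + poly B w
       + (\<Sum>l\<in>S. (2 * v n * v l + 2 * poly A w - (v n + v l) * poly D w) / (w - x l))
       + (\<Sum>k\<in>S. \<Sum>l\<in>S - {k}. 3 * poly F w / ((w - x l) * (w - x k))
            - poly G w / (w - x l) * ((v n + v k) / (w - x k) + (v l + v k) / (x l - x k))))"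
proof -
  let ?Q = "root_poly S x" and ?Qt = "root_poly_t S x v"
  let ?q = "poly ?Q w"
  define s1 where "s1 = (\<Sum>l\<in>S. 1 / (w - x l))"
  define s1v where "s1v = (\<Sum>l\<in>S. v l / (w - x l))"
  define s2 where "s2 = (\<Sum>k\<in>S. \<Sum>l\<in>S - {k}. 1 / ((w - x l) * (w - x k)))"
  define s2v where "s2v = (\<Sum>k\<in>S. \<Sum>l\<in>S - {k}. v k / ((w - x l) * (w - x k)))"
  have ne: "w \<noteq> x l" if "l \<in> S" for l
    using that inj n unfolding w_def inj_on_def by blast
  have injS: "inj_on x S" using inj by (rule inj_on_subset) auto
  have L: "poly [:- x n, 1:] w = 0" "pderiv [:- x n, 1:] = 1"
    by (simp_all add: w_def pderiv_pCons)
  have Qz: "poly (pderiv ?Q) w = ?q * s1"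
    unfolding s1_def using fin ne by (rule poly_pderiv_root_poly)
  have Qzz: "poly (pderiv (pderiv ?Q)) w = ?q * s2"
    unfolding s2_def using fin ne by (rule poly_pderiv2_root_poly)
  have Qt: "poly ?Qt w = - ?q * s1v"
    using fin ne by (simp add: s1v_def poly_root_poly_t sum_negf)
  have Qzt: "poly (pderiv ?Qt) w = - ?q * s2v"
    using fin ne by (simp add: s2v_def poly_pderiv_root_poly_t sum_negf)
  have sum1: "(\<Sum>l\<in>S. (2 * v n * v l + 2 * poly A w - (v n + v l) * poly D w) / (w - x l)) =
      2 * v n * s1v + 2 * poly A w * s1 - poly D w * (v n * s1 + s1v)"
    unfolding s1_def s1v_def sum_distrib_left sum.distrib[symmetric] sum_subtractf[symmetric]
    by (intro sum.cong refl) (simp add: diff_divide_distrib add_divide_distrib algebra_simps)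
  have "(\<Sum>k\<in>S. \<Sum>l\<in>S - {k}. 3 * poly F w / ((w - x l) * (w - x k))
            - poly G w / (w - x l) * ((v n + v k) / (w - x k) + (v l + v k) / (x l - x k)))
      = (\<Sum>k\<in>S. \<Sum>l\<in>S - {k}. 3 * poly F w * (1 / ((w - x l) * (w - x k)))
          - poly G w * (v n * (1 / ((w - x l) * (w - x k))) + v k / ((w - x l) * (w - x k))
              + (v l + v k) / ((w - x l) * (x l - x k))))"
    by (intro sum.cong refl) (simp add: add_divide_distrib algebra_simps)
  also have "\<dots> = 3 * poly F w * s2 - poly G w * (v n * s2 + s2v
      + (\<Sum>k\<in>S. \<Sum>l\<in>S - {k}. (v l + v k) / ((w - x l) * (x l - x k))))"
    by (simp only: s2_def s2v_def sum_distrib_left sum.distrib sum_subtractf distrib_left)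
  \<comment> \<open>The pair sum supplies a second \<open>s2v\<close>, matching the 2 in front of
    Q_zt in p_zzt.\<close>
  also have "\<dots> = 3 * poly F w * s2 - poly G w * (v n * s2 + 2 * s2v)"
    using sum_velocity_pairs[OF fin ne injS, of v] by (simp add: s2v_def)
  finally have sum2: "(\<Sum>k\<in>S. \<Sum>l\<in>S - {k}. 3 * poly F w / ((w - x l) * (w - x k))
            - poly G w / (w - x l) * ((v n + v k) / (w - x k) + (v l + v k) / (x l - x k)))
      = 3 * poly F w * s2 - poly G w * (v n * s2 + 2 * s2v)" .
  show ?thesis
    unfolding sum1 sum2 pde_poly_def root_poly_insert[OF fin n] root_poly_t_insert[OF fin n]
      root_poly_tt_insert[OF fin n] pderiv_add pderiv_mult pderiv_smult L(2) pderiv_1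
      poly_add poly_mult poly_smult L(1) Qz Qzz Qt Qzt poly_1
    by (simp add: algebra_simps Qz Qzz Qt Qzt)
qed

text \<open>The N-dependent coefficients of p_t, p_z and p are tuned for this: at degrees N and N+1
  the contributions of each parameter cancel separately, and above N+1 nothing contributes.\<close>

lemma coeff_pde_poly_high:
  fixes c :: complex
  assumes N: "N \<ge> 1" and c: "c = of_nat N" and i: "i \<ge> N"
    and p: "degree p \<le> N" and p': "degree p' \<le> N - 1" and p'': "degree p'' \<le> N - 1"
  shows "coeff (pde_poly [:E, - ((c - 1) * (D2 + (c - 2) * G3)):] [:G0, G1, G2, G3:]
     [:D0, D1, D2:] [:F0, F1, F2, F3, F4:] [:A0, A1, A2, A3:]
     [:B0, B1, - ((c - 1) * (2 * A3 + 3 * (c - 2) * F4)):]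
     [:c * (- B1 - (c - 1) * (A2 + (c - 2) * F3)), c * ((c - 1) * (A3 + 2 * (c - 2) * F4)):]
     p p' p'') i = 0"
proof -
  have z: "coeff p k = 0" if "k > N" for k
    using p that by (intro coeff_eq_0) auto
  have z': "coeff p' k = 0" "coeff p'' k = 0" if "k \<ge> N" for k
    using p' p'' that N by (auto intro!: coeff_eq_0)
  \<comment> \<open>Each coefficient polynomial has degree at most one more than the number of
    z-derivatives it multiplies, so degree \<open>i\<close> sees no coefficient of index below
    \<open>j\<close>. Of the others, those of \<open>p\<close> above \<open>i\<close> and those of
    \<open>p'\<close> above \<open>j\<close> vanish by the degree bounds.\<close>
  obtain j where j: "i = Suc j" "N \<le> Suc j" using N i by (cases i) auto
  define y :: complex where "y = of_nat j"
  \<comment> \<open>The factors in \<open>y\<close> are falling factorials of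
    \<open>i = y + 1\<close> and \<open>j = y\<close>; they vanish precisely when the shift would
    leave the natural numbers, so small \<open>j\<close> is covered too.\<close>
  have F: "coeff ([:F0, F1, F2, F3, F4:] * pderiv (pderiv (pderiv p))) i =
      F3 * (y + 1) * y * (y - 1) * coeff p i + F4 * y * (y - 1) * (y - 2) * coeff p j"
    using j z by (auto simp: y_def coeff_pCons coeff_pderiv algebra_simps split: nat.splits)
  have A: "coeff ([:A0, A1, A2, A3:] * pderiv (pderiv p)) i =
      A2 * (y + 1) * y * coeff p i + A3 * y * (y - 1) * coeff p j"
    using j z by (auto simp: y_def coeff_pCons coeff_pderiv algebra_simps split: nat.splits)
  have B: "coeff ([:B0, B1, b:] * pderiv p) i = B1 * (y + 1) * coeff p i + b * y * coeff p j" for b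
    using j z by (auto simp: y_def coeff_pCons coeff_pderiv algebra_simps split: nat.splits)
  have H: "coeff ([:h, k:] * p) i = h * coeff p i + k * coeff p j" for h k
    using j by (simp add: coeff_pCons)
  have C: "coeff ([:h, k:] * p') i = k * coeff p' j" for h k
    using j z' by (simp add: coeff_pCons)
  have G: "coeff ([:G0, G1, G2, G3:] * pderiv (pderiv p')) i = G3 * y * (y - 1) * coeff p' j"
    using j z' by (auto simp: y_def coeff_pCons coeff_pderiv algebra_simps split: nat.splits)
  have D: "coeff ([:D0, D1, D2:] * pderiv p') i = D2 * y * coeff p' j"
    using j z' by (auto simp: y_def coeff_pCons coeff_pderiv algebra_simps split: nat.splits)
  consider "N = Suc j" | "N = j" | "N < j" using j by linarith
  then show ?thesis
  proof cases
    case 1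
    then have "c = y + 1" by (simp add: c y_def)
    then show ?thesis
      unfolding pde_poly_def coeff_add F A B H C G D using 1 j z' by (simp add: algebra_simps)
  next
    case 2
    then have "c = y" by (simp add: c y_def)
    then show ?thesis
      unfolding pde_poly_def coeff_add F A B H C G D using 2 j z z' by (simp add: algebra_simps)
  next
    case 3
    then show ?thesis
      unfolding pde_poly_def coeff_add F A B H C G D using j z z' by simp
  qed
qed

lemma poly_eq_0_iff_roots:
  fixes p :: "complex poly"
  assumes "inj_on x S" "finite S" "card S > 0" "\<And>i. i \<ge> card S \<Longrightarrow> coeff p i = 0"
  shows "p = 0 \<longleftrightarrow> (\<forall>n\<in>S. poly p (x n) = 0)"
proof
  assume *: "\<forall>n\<in>S. poly p (x n) = 0"
  show "p = 0"
  proof (rule ccontr)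
    assume "p \<noteq> 0"
    then have "card (x ` S) \<le> degree p"
      using * card_mono[OF poly_roots_finite[of p], of "x ` S"] card_poly_roots_bound[of p]
      by fastforce
    then have "coeff p (degree p) = 0" using assms by (simp add: card_image)
    with \<open>p \<noteq> 0\<close> show False by simp
  qed
qed simp

subsection \<open>Differentiating polynomials with respect to a parameter\<close>

text \<open>Coefficientwise differentiation commutes with \<^term>\<open>pderiv\<close>, which spares interchanging
  the derivatives in \<open>z\<close> and \<open>t\<close> analytically.\<close>
definition has_poly_derivative ::
  "(real \<Rightarrow> complex poly) \<Rightarrow> complex poly \<Rightarrow> real \<Rightarrow> bool" where
  "has_poly_derivative P P' t \<longleftrightarrow>
     (\<forall>i. ((\<lambda>s. coeff (P s) i) has_vector_derivative coeff P' i) (at t))"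

lemma has_poly_derivative_const: "has_poly_derivative (\<lambda>s. p) 0 t"
  by (simp add: has_poly_derivative_def)

lemma has_poly_derivative_add:
  assumes "has_poly_derivative P P' t" "has_poly_derivative Q Q' t"
  shows "has_poly_derivative (\<lambda>s. P s + Q s) (P' + Q') t"
  using assms by (auto simp: has_poly_derivative_def intro!: derivative_intros)

lemma has_poly_derivative_sum:
  assumes "\<And>l. l \<in> S \<Longrightarrow> has_poly_derivative (P l) (P' l) t"
  shows "has_poly_derivative (\<lambda>s. \<Sum>l\<in>S. P l s) (\<Sum>l\<in>S. P' l) t"
  using assms
  by (induction S rule: infinite_finite_induct)
     (auto intro: has_poly_derivative_const has_poly_derivative_add)

lemma has_poly_derivative_mult:
  assumes "has_poly_derivative P P' t" "has_poly_derivative Q Q' t"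
  shows "has_poly_derivative (\<lambda>s. P s * Q s) (P t * Q' + P' * Q t) t"
  using assms unfolding has_poly_derivative_def coeff_add coeff_mult sum.distrib[symmetric]
  by (auto intro!: has_vector_derivative_sum has_vector_derivative_mult)

lemma has_poly_derivative_smult:
  assumes "(f has_vector_derivative f') (at t)" "has_poly_derivative Q Q' t"
  shows "has_poly_derivative (\<lambda>s. smult (f s) (Q s)) (smult f' (Q t) + smult (f t) Q') t"
  using assms unfolding has_poly_derivative_def coeff_add coeff_smult
  by (subst add.commute) (auto intro!: has_vector_derivative_mult)

lemma has_poly_derivative_pderiv:
  assumes "has_poly_derivative P P' t"
  shows "has_poly_derivative (\<lambda>s. pderiv (P s)) (pderiv P') t"
  using assms unfolding has_poly_derivative_def coeff_pderiv
  by (auto intro!: has_vector_derivative_mult_right)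

text \<open>The degree bound, uniform in \<open>s\<close>, turns evaluation into a sum over a fixed
  finite index set, which can be differentiated termwise.\<close>

lemma has_vector_derivative_poly:
  assumes P: "has_poly_derivative P P' t" and deg: "\<And>s. degree (P s) \<le> N"
  shows "((\<lambda>s. poly (P s) w) has_vector_derivative poly P' w) (at t)"
proof -
  have exp: "poly p w = (\<Sum>i\<le>N. coeff p i * w ^ i)" if "degree p \<le> N" for p
    unfolding poly_altdef using that
    by (intro sum.mono_neutral_left) (auto simp: coeff_eq_0)
  \<comment> \<open>\<open>P'\<close> inherits the bound: these coefficients of \<open>P s\<close>
    are constantly zero, and derivatives are unique.\<close>
  have "coeff P' i = 0" if "i > N" for i
  proof -
    have "coeff (P s) i = 0" for s
      using that deg[of s] by (intro coeff_eq_0) simp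
    then have "((\<lambda>s. 0) has_vector_derivative coeff P' i) (at t)"
      using P unfolding has_poly_derivative_def by (metis (no_types, lifting) ext)
    then show ?thesis
      using vector_derivative_unique_at has_vector_derivative_const by blast
  qed
  then have "degree P' \<le> N" by (intro degree_le) auto
  then show ?thesis
    using P unfolding exp[OF deg] exp[OF \<open>degree P' \<le> N\<close>] has_poly_derivative_def
    by (intro has_vector_derivative_sum has_vector_derivative_mult_left) auto
qed

text \<open>Justifies the formal \<open>root_poly_t\<close>: by induction,
  \<open>root_poly_t_insert\<close> is the product rule for one more moving factor.\<close>

lemma has_poly_derivative_root_poly:
  assumes "\<And>n. n \<in> S \<Longrightarrow> (z n has_vector_derivative v n) (at t)"
  shows "has_poly_derivative (\<lambda>s. root_poly S (\<lambda>n. z n s)) (root_poly_t S (\<lambda>n. z n t) v) t"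
  using assms
proof (induction S rule: infinite_finite_induct)
  case (insert n S)
  have "has_poly_derivative (\<lambda>s. [:- z n s, 1:]) [:- v n:] t"
    using insert.prems[of n] unfolding has_poly_derivative_def
    by (auto simp: coeff_pCons split: nat.splits intro!: derivative_intros)
  then have "has_poly_derivative (\<lambda>s. [:- z n s, 1:] * root_poly S (\<lambda>n. z n s))
      ([:- z n t, 1:] * root_poly_t S (\<lambda>n. z n t) v + [:- v n:] * root_poly S (\<lambda>n. z n t)) t"
    using insert by (intro has_poly_derivative_mult) auto
  then show ?case
    using insert.hyps by (simp add: root_poly_insert root_poly_t_insert add.commute)
qed (simp_all add: root_poly_def root_poly_t_def has_poly_derivative_const)

lemma has_poly_derivative_root_poly_t:
  assumes "\<And>n. n \<in> S \<Longrightarrow> (z n has_vector_derivative v n t) (at t)"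
    and "\<And>n. n \<in> S \<Longrightarrow> (v n has_vector_derivative a n) (at t)"
  shows "has_poly_derivative (\<lambda>s. root_poly_t S (\<lambda>n. z n s) (\<lambda>n. v n s))
    (root_poly_tt S (\<lambda>n. z n t) (\<lambda>n. v n t) a) t"
  unfolding root_poly_t_def[of S] root_poly_tt_def
  using assms
  by (intro has_poly_derivative_sum has_poly_derivative_smult has_poly_derivative_root_poly)
     (auto intro!: derivative_intros)

text \<open>An equation between functions of both arguments, so that it rewrites iterated
  \<open>d_z\<close>; \<open>d_t_poly\<close> below can only be pointwise in
  \<open>t\<close>.\<close>

lemma d_z_poly: "d_z (\<lambda>w t. poly (P t) w) = (\<lambda>w t. poly (pderiv (P t)) w)"
  by (auto simp: d_z_def fun_eq_iff intro!: DERIV_imp_deriv poly_DERIV)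

lemma d_t_poly:
  assumes "has_poly_derivative P P' t" "\<And>s. degree (P s) \<le> N"
  shows "d_t (\<lambda>w t. poly (P t) w) w t = poly P' w"
  unfolding d_t_def dot_def
  by (rule vector_derivative_at[OF has_vector_derivative_poly[OF assms]])

lemma C2_on_has_vector_derivative:
  assumes "C2_on f S" "t \<in> S"
  shows "(f has_vector_derivative dot f t) (at t)"
    and "(dot f has_vector_derivative dot (dot f) t) (at t)"
  using assms by (auto simp: C2_on_def C1_differentiable_on_def dot_def
      intro: vector_derivative_works[THEN iffD1] differentiableI_vector)

theorem mainTheorem1:
  fixes N :: nat
    and A0 A1 A2 A3 B0 B1 D0 D1 D2 E F0 F1 F2 F3 F4 G0 G1 G2 G3 :: complex
    and z :: "nat \<Rightarrow> real \<Rightarrow> complex"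
    and T :: "real set"
  assumes "N \<ge> 1"
    and "open T" and "is_interval T"
    and "\<And>n. n \<in> {1..N} \<Longrightarrow> C2_on (z n) T"
    and "\<And>t m n. \<lbrakk>t \<in> T; m \<in> {1..N}; n \<in> {1..N}; m \<noteq> n\<rbrakk> \<Longrightarrow> z m t \<noteq> z n t"
  shows
    "(\<forall>t\<in>T. \<forall>n\<in>{1..N}.
        dot (dot (z n)) t + E * dot (z n) t =
          B0 + B1 * z n t
          - (of_nat N - 1) * (2 * A3 + 3 * (of_nat N - 2) * F4) * (z n t)^2
          + (of_nat N - 1) * (of_nat N - 2) * G3 * dot (z n) t * z n t
          + (\<Sum>l\<in>{1..N} - {n}.
               (2 * dot (z n) t * dot (z l) t
                + 2 * (A0 + A1 * z n t + A2 * (z n t)^2 + A3 * (z n t)^3)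
                - (dot (z n) t + dot (z l) t) * (D0 + D1 * z n t)
                - D2 * z n t * (dot (z n) t * z l t + dot (z l) t * z n t))
               / (z n t - z l t))
          + (\<Sum>k\<in>{1..N} - {n}. \<Sum>l\<in>{1..N} - {n, k}.
               3 * (F0 + F1 * z n t + F2 * (z n t)^2 + F3 * (z n t)^3 + F4 * (z n t)^4)
                 / ((z n t - z l t) * (z n t - z k t))
               - (G0 + G1 * z n t + G2 * (z n t)^2 + G3 * (z n t)^3) / (z n t - z l t)
                 * ((dot (z n) t + dot (z k) t) / (z n t - z k t)
                    + (dot (z l) t + dot (z k) t) / (z l t - z k t))))
     \<longleftrightarrow>
     (\<forall>w::complex. \<forall>t\<in>T.
        d_t (d_t (psi N z)) w t
        + (E - (of_nat N - 1) * (D2 + (of_nat N - 2) * G3) * w) * d_t (psi N z) w t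
        + (G0 + G1 * w + G2 * w^2 + G3 * w^3) * d_t (d_z (d_z (psi N z))) w t
        + (D0 + D1 * w + D2 * w^2) * d_t (d_z (psi N z)) w t
        + (F0 + F1 * w + F2 * w^2 + F3 * w^3 + F4 * w^4) * d_z (d_z (d_z (psi N z))) w t
        + (A0 + A1 * w + A2 * w^2 + A3 * w^3) * d_z (d_z (psi N z)) w t
        + (B0 + B1 * w - (of_nat N - 1) * (2 * A3 + 3 * (of_nat N - 2) * F4) * w^2)
            * d_z (psi N z) w t
        + of_nat N * (- B1 - (of_nat N - 1) * (A2 + (of_nat N - 2) * F3)
            + (of_nat N - 1) * (A3 + 2 * (of_nat N - 2) * F4) * w) * psi N z w t
        = 0)"
proof -
  let ?I = "{1..N}"
  define c :: complex where "c = of_nat N"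
  define x where "x = (\<lambda>t n. z n t)"
  define v where "v = (\<lambda>t n. dot (z n) t)"
  define a where "a = (\<lambda>t n. dot (dot (z n)) t)"
  define P where "P = (\<lambda>t. root_poly ?I (x t))"
  define Pt where "Pt = (\<lambda>t. root_poly_t ?I (x t) (v t))"
  define Ptt where "Ptt = (\<lambda>t. root_poly_tt ?I (x t) (v t) (a t))"
  define C where "C = [:E, - ((c - 1) * (D2 + (c - 2) * G3)):]"
  define B where "B = [:B0, B1, - ((c - 1) * (2 * A3 + 3 * (c - 2) * F4)):]"
  define H where "H = [:c * (- B1 - (c - 1) * (A2 + (c - 2) * F3)),
    c * ((c - 1) * (A3 + 2 * (c - 2) * F4)):]"
  define A where "A = [:A0, A1, A2, A3:]"
  define D where "D = [:D0, D1, D2:]"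
  define F where "F = [:F0, F1, F2, F3, F4:]"
  define G where "G = [:G0, G1, G2, G3:]"
  define R where "R = (\<lambda>t. pde_poly C G D F A B H (P t) (Pt t) (Ptt t))"
  note C2 = C2_on_has_vector_derivative[OF assms(4)]

  \<comment> \<open>Analytic derivatives of psi as values of polynomials\<close>
  have degP: "degree (P s) \<le> N" and degPt: "degree (Pt s) \<le> N - 1"
    and degPtt: "degree (Ptt s) \<le> N - 1" for s
    using degree_root_poly_t_le[of ?I] degree_root_poly_tt_le[of ?I]
    by (auto simp: P_def Pt_def Ptt_def degree_root_poly)
  have psi: "psi N z = (\<lambda>w t. poly (P t) w)"
    by (simp add: fun_eq_iff psi_def P_def x_def poly_root_poly)
  have dz: "d_z (psi N z) = (\<lambda>w t. poly (pderiv (P t)) w)"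
    "d_z (d_z (psi N z)) = (\<lambda>w t. poly (pderiv (pderiv (P t))) w)"
    "d_z (d_z (d_z (psi N z))) = (\<lambda>w t. poly (pderiv (pderiv (pderiv (P t)))) w)"
    by (simp_all only: psi d_z_poly)
  have P': "has_poly_derivative P (Pt t) t" if "t \<in> T" for t
    unfolding P_def Pt_def x_def v_def
    using C2(1) that by (intro has_poly_derivative_root_poly) auto
  have P'': "has_poly_derivative Pt (Ptt t) t" if "t \<in> T" for t
    unfolding Pt_def Ptt_def x_def v_def a_def
    using C2 that by (intro has_poly_derivative_root_poly_t) auto
  have deg1: "degree (pderiv (P s)) \<le> N" and deg2: "degree (pderiv (pderiv (P s))) \<le> N" for s
    using degP[of s] by (auto simp: degree_pderiv)
  have dt: "d_t (psi N z) w t = poly (Pt t) w" if "t \<in> T" for w t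
    unfolding psi by (rule d_t_poly[OF P'[OF that] degP])
  have dzt: "d_t (d_z (psi N z)) w t = poly (pderiv (Pt t)) w" if "t \<in> T" for w t
    unfolding dz(1) by (rule d_t_poly[OF has_poly_derivative_pderiv[OF P'[OF that]] deg1])
  have dzzt: "d_t (d_z (d_z (psi N z))) w t = poly (pderiv (pderiv (Pt t))) w" if "t \<in> T" for w t
    unfolding dz(2)
    by (rule d_t_poly[OF has_poly_derivative_pderiv[OF has_poly_derivative_pderiv[OF P'[OF that]]]
          deg2])
  \<comment> \<open>The first time derivative is identified with \<open>Pt\<close> only on
    \<open>T\<close>; openness of \<open>T\<close> makes the two agree near \<open>t\<close>, which
    suffices to differentiate again.\<close>
  have dtt: "d_t (d_t (psi N z)) w t = poly (Ptt t) w" if "t \<in> T" for w t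
    unfolding d_t_def[of "d_t _"] dot_def
    by (intro vector_derivative_at has_vector_derivative_transform_within_open
        [OF has_vector_derivative_poly[OF P''[OF that] degPt] assms(2) that]) (simp add: dt)

  \<comment> \<open>Reduction to the zeros and comparison with the equations of motion\<close>
  have inj: "inj_on (x t) ?I" if "t \<in> T" for t
    using assms(5)[OF that] unfolding inj_on_def x_def by blast
  have "R t = 0 \<longleftrightarrow> (\<forall>n\<in>?I. poly (R t) (x t n) = 0)" if "t \<in> T" for t
  proof (rule poly_eq_0_iff_roots[OF inj[OF that]])
    fix i assume "card ?I \<le> i"
    then show "coeff (R t) i = 0"
      unfolding R_def C_def G_def D_def F_def A_def B_def H_def
      using assms(1) c_def degP degPt degPtt by (intro coeff_pde_poly_high) auto
  qed (use assms(1) in auto)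
  then have pde: "(\<forall>w. poly (R t) w = 0) \<longleftrightarrow> (\<forall>n\<in>?I. poly (R t) (x t n) = 0)" if "t \<in> T" for t
    using that by (metis poly_all_0_iff_0)

  have eom: "poly (R t) (x t n) = 0 \<longleftrightarrow>
      a t n + E * v t n =
          B0 + B1 * x t n
          - (c - 1) * (2 * A3 + 3 * (c - 2) * F4) * (x t n)^2
          + (c - 1) * (c - 2) * G3 * v t n * x t n
          + (\<Sum>l\<in>?I - {n}.
               (2 * v t n * v t l
                + 2 * (A0 + A1 * x t n + A2 * (x t n)^2 + A3 * (x t n)^3)
                - (v t n + v t l) * (D0 + D1 * x t n)
                - D2 * x t n * (v t n * x t l + v t l * x t n))
               / (x t n - x t l))
          + (\<Sum>k\<in>?I - {n}. \<Sum>l\<in>?I - {n, k}.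
               3 * (F0 + F1 * x t n + F2 * (x t n)^2 + F3 * (x t n)^3 + F4 * (x t n)^4)
                 / ((x t n - x t l) * (x t n - x t k))
               - (G0 + G1 * x t n + G2 * (x t n)^2 + G3 * (x t n)^3) / (x t n - x t l)
                 * ((v t n + v t k) / (x t n - x t k)
                    + (v t l + v t k) / (x t l - x t k)))"
    (is "_ \<longleftrightarrow> _ = _ + ?s1 + ?s2") if t: "t \<in> T" and n: "n \<in> ?I" for t n
  proof -
    let ?S = "?I - {n}"
    let ?w = "x t n"
    have I: "insert n ?S = ?I" using n by auto
    have ne: "?w \<noteq> x t l" if "l \<in> ?S" for l
      using that n inj[OF t] by (auto dest: inj_onD)
    \<comment> \<open>This is the product of the differences of zeros that is divided out
      below.\<close>
    have q: "poly (root_poly ?S (x t)) ?w \<noteq> 0"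
      using ne by (auto simp: poly_root_poly)
    have p: "poly A ?w = A0 + A1 * ?w + A2 * ?w^2 + A3 * ?w^3"
      "poly F ?w = F0 + F1 * ?w + F2 * ?w^2 + F3 * ?w^3 + F4 * ?w^4"
      "poly G ?w = G0 + G1 * ?w + G2 * ?w^2 + G3 * ?w^3"
      by (simp_all add: A_def F_def G_def power2_eq_square power3_eq_cube power4_eq_xxxx algebra_simps)
    \<comment> \<open>Substituting z_l = z_n - (z_n - z_l) in the \<open>D2\<close> term completes
      \<open>D0 + D1 * ?w\<close> to \<open>poly D ?w\<close> and leaves
      \<open>D2 * ?w * v t n\<close> for each of the N-1 indices \<open>l\<close>.\<close>
    have "?s1 = (\<Sum>l\<in>?S. (2 * v t n * v t l + 2 * poly A ?w - (v t n + v t l) * poly D ?w) / (?w - x t l)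
        + D2 * ?w * v t n)"
      unfolding p
    proof (intro sum.cong refl)
      fix l assume "l \<in> ?S"
      then have nz: "?w - x t l \<noteq> 0" using ne by auto
      show "(2 * v t n * v t l + 2 * (A0 + A1 * ?w + A2 * ?w^2 + A3 * ?w^3)
          - (v t n + v t l) * (D0 + D1 * ?w) - D2 * ?w * (v t n * x t l + v t l * ?w)) / (?w - x t l)
        = (2 * v t n * v t l + 2 * (A0 + A1 * ?w + A2 * ?w^2 + A3 * ?w^3)
            - (v t n + v t l) * poly D ?w) / (?w - x t l) + D2 * ?w * v t n"
        by (simp only: D_def divide_add_eq_iff[OF nz]) (simp add: algebra_simps power2_eq_square)
    qed
    also have "\<dots> = (\<Sum>l\<in>?S. (2 * v t n * v t l + 2 * poly A ?w - (v t n + v t l) * poly D ?w)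
        / (?w - x t l)) + (c - 1) * (D2 * ?w * v t n)"
      using n assms(1) by (simp add: sum.distrib c_def of_nat_diff)
    finally have s1: "?s1 = (\<Sum>l\<in>?S. (2 * v t n * v t l + 2 * poly A ?w - (v t n + v t l) * poly D ?w)
        / (?w - x t l)) + (c - 1) * (D2 * ?w * v t n)" .
    have s2: "?s2 = (\<Sum>k\<in>?S. \<Sum>l\<in>?S - {k}. 3 * poly F ?w / ((?w - x t l) * (?w - x t k))
            - poly G ?w / (?w - x t l) * ((v t n + v t k) / (?w - x t k) + (v t l + v t k) / (x t l - x t k)))"
      unfolding p by (intro sum.cong) auto
    have "poly (R t) ?w = poly (root_poly ?S (x t)) ?w *
        (- a t n - poly C ?w * v t n + poly B ?w + (?s1 - (c - 1) * (D2 * ?w * v t n)) + ?s2)"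
      unfolding R_def P_def Pt_def Ptt_def s1 s2 add_diff_cancel_right'
      using poly_pde_poly_at_root[of ?S n "x t" C G D F A B H "v t" "a t"] inj[OF t]
      unfolding I by simp
    then have "poly (R t) ?w = 0 \<longleftrightarrow>
        - a t n - poly C ?w * v t n + poly B ?w + (?s1 - (c - 1) * (D2 * ?w * v t n)) + ?s2 = 0"
      using q by simp
    \<comment> \<open>The \<open>D2\<close> part of \<open>C\<close> cancels the correction found
      above; its \<open>G3\<close> part remains as the term in z_n times its velocity. The sums are
      generalised to \<open>s\<close> and \<open>s'\<close> so that the algebra treats them as
      atoms.\<close>
    also have "- a t n - poly C ?w * v t n + poly B ?w + (s - (c - 1) * (D2 * ?w * v t n)) + s' = 0
      \<longleftrightarrow> a t n + E * v t n = B0 + B1 * ?w - (c - 1) * (2 * A3 + 3 * (c - 2) * F4) * ?w^2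
          + (c - 1) * (c - 2) * G3 * v t n * ?w + s + s'" for s s'
      unfolding C_def B_def by (simp add: power2_eq_square) algebra
    finally show ?thesis .
  qed

  \<comment> \<open>The differential equation as vanishing of \<open>R t\<close>\<close>
  have "poly (R t) w =
        d_t (d_t (psi N z)) w t
        + (E - (of_nat N - 1) * (D2 + (of_nat N - 2) * G3) * w) * d_t (psi N z) w t
        + (G0 + G1 * w + G2 * w^2 + G3 * w^3) * d_t (d_z (d_z (psi N z))) w t
        + (D0 + D1 * w + D2 * w^2) * d_t (d_z (psi N z)) w t
        + (F0 + F1 * w + F2 * w^2 + F3 * w^3 + F4 * w^4) * d_z (d_z (d_z (psi N z))) w t
        + (A0 + A1 * w + A2 * w^2 + A3 * w^3) * d_z (d_z (psi N z)) w t
        + (B0 + B1 * w - (of_nat N - 1) * (2 * A3 + 3 * (of_nat N - 2) * F4) * w^2)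
            * d_z (psi N z) w t
        + of_nat N * (- B1 - (of_nat N - 1) * (A2 + (of_nat N - 2) * F3)
            + (of_nat N - 1) * (A3 + 2 * (of_nat N - 2) * F4) * w) * psi N z w t"
    if "t \<in> T" for w t
  proof -
    have coeffs: "poly C w = E - (c - 1) * (D2 + (c - 2) * G3) * w"
      "poly G w = G0 + G1 * w + G2 * w^2 + G3 * w^3"
      "poly D w = D0 + D1 * w + D2 * w^2"
      "poly F w = F0 + F1 * w + F2 * w^2 + F3 * w^3 + F4 * w^4"
      "poly A w = A0 + A1 * w + A2 * w^2 + A3 * w^3"
      "poly B w = B0 + B1 * w - (c - 1) * (2 * A3 + 3 * (c - 2) * F4) * w^2"
      "poly H w = c * (- B1 - (c - 1) * (A2 + (c - 2) * F3) + (c - 1) * (A3 + 2 * (c - 2) * F4) * w)"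
      by (simp_all add: C_def G_def D_def F_def A_def B_def H_def
          power2_eq_square power3_eq_cube power4_eq_xxxx algebra_simps)
    show ?thesis
      unfolding dtt[OF that] dt[OF that] dzt[OF that] dzzt[OF that]
      unfolding dz unfolding psi c_def[symmetric] coeffs[symmetric]
      by (simp only: R_def pde_poly_def poly_add poly_mult d_z_poly)
  qed
  with pde eom show ?thesis
    unfolding x_def v_def a_def c_def by (metis (no_types, lifting))
qed

end
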